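(* For $m,n\in\mathbb{N}$ with $m\le n$, \[ \binom{n-1}{m-1}N_{n-m}^{(-n)}=n!\sum_{k=0}^{n-m}\frac{\binom{n-1}{k+m-1}\binom{k+m-1}{k}}{(k+m)!}N_k^{(-n)}(-n). \]
   Context: For a real (or complex) $a$, the Narumi polynomials of order $a$ are defined by $\sum_{k\ge0}N_k^{(a)}(x)\frac{t^k}{k!}=\left(\frac{\log(1+t)}{t}\right)^a(1+t)^x$, and $N_k^{(a)}=N_k^{(a)}(0)$. *)

theory Defs
  imports "HOL-Computational_Algebra.Formal_Power_Series"
begin

text \<open>
  For a formal power series \<open>F\<close> with constant term \<open>1\<close> and an arbitrary exponent \<open>a\<close> (not
  necessarily an integer), \<open>F\<^sup>a\<close> is the binomial series \<open>(1 + u)\<^sup>a = \<Sum>j. (a gchoose j) u\<^sup>j\<close>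
  at \<open>u = F - 1\<close>.
\<close>

definition fps_gpow :: "'a::field_char_0 fps \<Rightarrow> 'a \<Rightarrow> 'a fps" where
  "fps_gpow F a = fps_compose (fps_binomial a) (F - 1)"

text \<open>\<open>fps_ln 1\<close> is the expansion of \<open>log (1 + t)\<close>, and \<open>fps_binomial x\<close> that of \<open>(1 + t)\<^sup>x\<close>.\<close>

definition narumi_gf :: "'a::field_char_0 \<Rightarrow> 'a \<Rightarrow> 'a fps" where
  "narumi_gf a x = fps_gpow (fps_ln 1 / fps_X) a * fps_binomial x"

definition narumi :: "nat \<Rightarrow> 'a::field_char_0 \<Rightarrow> 'a \<Rightarrow> 'a" where
  "narumi k a x = fact k * fps_nth (narumi_gf a x) k"

abbreviation narumi_number :: "nat \<Rightarrow> 'a::field_char_0 \<Rightarrow> 'a" where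
  "narumi_number k a \<equiv> narumi k a 0"

lemma narumi_generating_function:
  "Abs_fps (\<lambda>k. narumi k a x / fact k) = narumi_gf a x"
  by (simp add: fps_eq_iff narumi_def)

lemma fps_ln_div_X_nth:
  "fps_nth (fps_ln 1 / fps_X :: 'a::field_char_0 fps) k = (- 1) ^ k / of_nat (Suc k)"
  by (simp add: fps_ln_def)

lemma fps_gpow_of_nat:
  fixes F :: "'a::field_char_0 fps"
  assumes "fps_nth F 0 = 1"
  shows "fps_gpow F (of_nat n) = F ^ n"
proof -
  have F0: "fps_nth (F - 1) 0 = 0"
    using assms by simp
  have "(1 + fps_X) ^ n oo (F - 1) = ((1 + fps_X) oo (F - 1)) ^ n"
    using fps_compose_power[OF F0] by simp
  also have "(1 + fps_X) oo (F - 1) = F"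
    using F0 by (simp add: fps_compose_add_distrib)
  finally show ?thesis
    by (simp add: fps_gpow_def fps_binomial_of_nat)
qed

lemma fps_gpow_add:
  fixes F :: "'a::field_char_0 fps"
  assumes "fps_nth F 0 = 1"
  shows "fps_gpow F (a + b) = fps_gpow F a * fps_gpow F b"
  using assms by (simp add: fps_gpow_def fps_binomial_add_mult fps_compose_mult_distrib)

end

theory Submission
  imports Defs
begin

text \<open>
  The generating functions satisfy \<open>narumi_gf a (x + y) = narumi_gf a x * (1 + t)\<^sup>y\<close>. For
  \<open>a = x = - n\<close> and \<open>y = n\<close>, the coefficient of \<open>t\<^sup>n\<^sup>-\<^sup>m\<close> expresses \<open>N\<^bsub>n-m\<^esub>\<close> through the
  values at \<open>- n\<close> with weights \<open>n choose (n - m - k) = n choose (k + m)\<close>; clearing factorials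
  gives the weights of the theorem.
\<close>

lemma narumi_gf_add: "narumi_gf a (x + y) = narumi_gf a x * fps_binomial y"
  by (simp add: narumi_gf_def fps_binomial_add_mult mult.assoc)

lemma narumi_add:
  "narumi k a (x + y) = fact k * (\<Sum>i = 0..k. narumi i a x / fact i * (y gchoose (k - i)))"
  by (simp add: narumi_def narumi_gf_add fps_mult_nth)

text \<open>In factorials both sides equal
  \<open>n! (n-1)! / (k! (m-1)! (k+m)! (n-m-k)!)\<close>.\<close>

lemma binomial_product_fact:
  fixes k m n :: nat
  assumes "1 \<le> m" and "k + m \<le> n"
  shows "fact n * (of_nat (((n - 1) choose (k + m - 1)) * ((k + m - 1) choose k)) / fact (k + m)) =
    of_nat ((n - 1) choose (m - 1)) * fact (n - m) * of_nat (n choose (n - m - k)) / 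
      (fact k :: 'a::field_char_0)"
proof -
  \<comment> \<open>The complementary lower indices that \<open>binomial_fact\<close> produces, with
    truncated subtraction resolved.\<close>
  have "n - 1 - (k + m - 1) = n - m - k" "k + m - 1 - k = m - 1" "n - 1 - (m - 1) = n - m"
    "n - (n - m - k) = k + m"
    using assms by auto
  moreover have "k + m - 1 \<le> n - 1" "k \<le> k + m - 1" "m - 1 \<le> n - 1" "n - m - k \<le> n"
    using assms by auto
  ultimately show ?thesis
    by (simp add: binomial_fact mult_ac)
qed

theorem theorem12:
  fixes m n :: nat
  assumes "1 \<le> m" and "m \<le> n"
  shows "of_nat ((n - 1) choose (m - 1)) * narumi_number (n - m) (- of_nat n :: 'a::field_char_0) =
    fact n * (\<Sum>k = 0..n - m.
      of_nat (((n - 1) choose (k + m - 1)) * ((k + m - 1) choose k)) / fact (k + m)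
        * narumi k (- of_nat n) (- of_nat n))"
proof -
  let ?a = "- of_nat n :: 'a"
  have "of_nat ((n - 1) choose (m - 1)) * narumi_number (n - m) ?a =
      (\<Sum>k = 0..n - m. of_nat ((n - 1) choose (m - 1)) * fact (n - m) *
        of_nat (n choose (n - m - k)) / fact k * narumi k ?a ?a)"
    \<comment> \<open>The shift \<open>y = n\<close> moves the argument from \<open>- n\<close> to
      \<open>0\<close>; as \<open>y\<close> is a natural number, its \<open>gchoose\<close> weights
      are ordinary binomials.\<close>
    using narumi_add[of "n - m" ?a ?a "of_nat n"]
    by (simp add: binomial_gbinomial sum_distrib_left mult_ac)
  also have "\<dots> = (\<Sum>k = 0..n - m. fact n *
      (of_nat (((n - 1) choose (k + m - 1)) * ((k + m - 1) choose k)) / fact (k + m)) *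
        narumi k ?a ?a)"
    \<comment> \<open>The range \<open>k \<le> n - m\<close> together with \<open>m \<le> n\<close>
      gives \<open>k + m \<le> n\<close>.\<close>
    using assms by (intro sum.cong refl) (subst binomial_product_fact; simp)
  finally show ?thesis
    by (simp only: sum_distrib_left mult.assoc)
qed

end
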